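(* Every non-zero element $x\in\mathfrak{F}_{\mathbb{R}}$ is $\mathrm{SL}(2,\mathbb{R})$-related to one of the following canonical forms, listed according to the rank of $x$: 1. Rank 1: (a) $x_1=\begin{pmatrix}1&0\\0&0\end{pmatrix}$. 2. Rank 3: (a) $x_3=\begin{pmatrix}0&1\\0&0\end{pmatrix}$. 3. Rank 4: (a) $x_{4a}=k\begin{pmatrix}1&-1\\0&0\end{pmatrix}$; (b) $x_{4b}=k\begin{pmatrix}1&1\\0&0\end{pmatrix}$, where $k>0$.
   Context: Jordan algebra. $\mathfrak{J}_{\mathbb{R}}=\mathbb{R}$ with cubic norm $N(A)=A^3$, base point $1$, trace bilinear form $\mathrm{Tr}(A,B)=3AB$ and quadratic adjoint $A^\sharp=A^2$. Freudenthal triple system. $\mathfrak{F}_{\mathbb{R}}=\mathfrak{F}(\mathfrak{J}_{\mathbb{R}})=\mathbb{R}\oplus\mathbb{R}\oplus\mathfrak{J}_{\mathbb{R}}\oplus\mathfrak{J}_{\mathbb{R}}$, with elements written $x=\begin{pmatrix}\alpha & A \\ B & \beta\end{pmatrix}$, $\alpha,\beta,A,B\in\mathbb{R}$. For $y=\begin{pmatrix}\gamma & C \\ D & \delta\end{pmatrix}$, the antisymmetric bilinear form is $$\{x,y\}=\alpha\delta-\beta\gamma+\mathrm{Tr}(A,D)-\mathrm{Tr}(B,C),$$ and the quartic form is $$\Delta(x)=-(\alpha\beta-\mathrm{Tr}(A,B))^2-4[\alpha N(A)+\beta N(B)-\mathrm{Tr}(A^\sharp,B^\sharp)].$$ Let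 $\Delta(x,y,w,z)$ be its full symmetric linearization, normalized by $\Delta(x,x,x,x)=\Delta(x)$. The triple product $T$ is defined by $\{T(x,y,w),z\}=2\Delta(x,y,w,z)$ for all $z$, and $T(x):=T(x,x,x)$. Put $\Upsilon(x,x,y)=3T(x,x,y)+\{x,y\}x$. Rank. A non-zero $x$ has rank 1 iff $\Upsilon(x,x,y)=0$ for all $y$; rank 2 iff $T(x)=0$ and $\Upsilon(x,x,y)\neq0$ for some $y$; rank 3 iff $\Delta(x)=0$ and $T(x)\neq0$; rank 4 iff $\Delta(x)\ne0$. Group. Identify $x$ with the totally symmetric hypermatrix $a_{(A_1A_2A_3)}$, $A_i\in\{0,1\}$, given by $a_{000}=\alpha$, $a_{110}=a_{101}=a_{011}=A$, $a_{001}=a_{010}=a_{100}=B$, $a_{111}=\beta$. The automorphism group $\mathrm{SL}(2,\mathbb{R})$ of $\mathfrak{F}_{\mathbb{R}}$ acts by $a_{(A_1A_2A_3)}\mapsto \sum M_{A_1}{}^{A_1'}M_{A_2}{}^{A_2'}M_{A_3}{}^{A_3'}a_{(A_1'A_2'A_3')}$ for $M$ a real $2\times2$ matrix of determinant 1. Elements are $\mathrm{SL}(2,\mathbb{R})$-related if they lie in the same orbit. The real number $k>0$ depends on $x$. *)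

theory Defs
  imports "HOL-Analysis.Analysis"
begin

type_synonym jordan = real

definition jnorm :: "jordan \<Rightarrow> real" where
  "jnorm A = A ^ 3"

definition jtrace :: "jordan \<Rightarrow> jordan \<Rightarrow> real" where
  "jtrace A B = 3 * A * B"

definition jsharp :: "jordan \<Rightarrow> jordan" where
  "jsharp A = A ^ 2"

text \<open>The quadruple \<open>(\<alpha>, A, B, \<beta>)\<close> is the matrix with rows \<open>(\<alpha>, A)\<close> and \<open>(B, \<beta>)\<close>.
  Zero, addition and scalar multiplication are those of the product vector space.\<close>

type_synonym fts = "real \<times> jordan \<times> jordan \<times> real"

fun sform :: "fts \<Rightarrow> fts \<Rightarrow> real" where
  "sform (\<alpha>, A, B, \<beta>) (\<gamma>, C, D, \<delta>) = \<alpha> * \<delta> - \<beta> * \<gamma> + jtrace A D - jtrace B C"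

fun quartic :: "fts \<Rightarrow> real" where
  "quartic (\<alpha>, A, B, \<beta>) =
     - (\<alpha> * \<beta> - jtrace A B)\<^sup>2
     - 4 * (\<alpha> * jnorm A + \<beta> * jnorm B - jtrace (jsharp A) (jsharp B))"

text \<open>Full polarization, with the factor \<open>1/4!\<close> for which the diagonal of \<open>quartic_lin\<close>
  is \<open>quartic\<close>. The lemmas below show that \<open>quartic_lin\<close> is symmetric and four-linear with
  this diagonal.\<close>

definition polarize4 :: "('a::ab_group_add \<Rightarrow> real) \<Rightarrow> 'a \<Rightarrow> 'a \<Rightarrow> 'a \<Rightarrow> 'a \<Rightarrow> real" where
  "polarize4 q x y w z =
    (q (x + y + w + z)
     - q (x + y + w) - q (x + y + z) - q (x + w + z) - q (y + w + z)
     + q (x + y) + q (x + w) + q (x + z) + q (y + w) + q (y + z) + q (w + z)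
     - q x - q y - q w - q z) / 24"

definition quartic_lin :: "fts \<Rightarrow> fts \<Rightarrow> fts \<Rightarrow> fts \<Rightarrow> real" where
  "quartic_lin = polarize4 quartic"

definition triple :: "fts \<Rightarrow> fts \<Rightarrow> fts \<Rightarrow> fts" where
  "triple x y w = (THE t. \<forall>z. sform t z = 2 * quartic_lin x y w z)"

text \<open>\<open>upsilon x y\<close> is \<open>\<Upsilon>(x, x, y)\<close>.\<close>

definition upsilon :: "fts \<Rightarrow> fts \<Rightarrow> fts" where
  "upsilon x y = 3 *\<^sub>R triple x x y + sform x y *\<^sub>R x"

lemma polarize4_prod:
  fixes f g h k :: "'a::real_vector \<Rightarrow> real"
  assumes "linear f" "linear g" "linear h" "linear k"
  shows "polarize4 (\<lambda>v. f v * g v * h v * k v) x1 x2 x3 x4 =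
     (f x1 * g x2 * h x3 * k x4 + f x1 * g x2 * h x4 * k x3 + f x1 * g x3 * h x2 * k x4
      + f x1 * g x3 * h x4 * k x2 + f x1 * g x4 * h x2 * k x3 + f x1 * g x4 * h x3 * k x2
      + f x2 * g x1 * h x3 * k x4 + f x2 * g x1 * h x4 * k x3 + f x2 * g x3 * h x1 * k x4
      + f x2 * g x3 * h x4 * k x1 + f x2 * g x4 * h x1 * k x3 + f x2 * g x4 * h x3 * k x1
      + f x3 * g x1 * h x2 * k x4 + f x3 * g x1 * h x4 * k x2 + f x3 * g x2 * h x1 * k x4
      + f x3 * g x2 * h x4 * k x1 + f x3 * g x4 * h x1 * k x2 + f x3 * g x4 * h x2 * k x1
      + f x4 * g x1 * h x2 * k x3 + f x4 * g x1 * h x3 * k x2 + f x4 * g x2 * h x1 * k x3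
      + f x4 * g x2 * h x3 * k x1 + f x4 * g x3 * h x1 * k x2 + f x4 * g x3 * h x2 * k x1) / 24"
  unfolding polarize4_def assms[THEN linear_add]
  by (rule arg_cong[where f = "\<lambda>t. t / 24"]) algebra

lemma linear_polarize4_prod:
  fixes f g h k :: "'a::real_vector \<Rightarrow> real"
  assumes "linear f" "linear g" "linear h" "linear k"
  shows "linear (\<lambda>z. polarize4 (\<lambda>v. f v * g v * h v * k v) x y w z)"
proof -
  have left: "linear (\<lambda>z. c * p z)" and right: "linear (\<lambda>z. p z * c)"
    and div: "linear (\<lambda>z. p z / c)" if "linear p" for c and p :: "'a \<Rightarrow> real"
    using that by (auto simp: linear_iff algebra_simps add_divide_distrib)
  show ?thesis
    unfolding polarize4_prod[OF assms]
    by (intro div linear_compose_add left right assms)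
qed

lemma polarize4_combine:
  "polarize4 (\<lambda>v. p v + q v) x y w z = polarize4 p x y w z + polarize4 q x y w z"
  "polarize4 (\<lambda>v. c * p v) x y w z = c * polarize4 p x y w z"
  by (simp_all add: polarize4_def algebra_simps add_divide_distrib diff_divide_distrib)

lemma quartic_alt:
  defines "a \<equiv> fst :: fts \<Rightarrow> real"
    and "b \<equiv> (\<lambda>v :: fts. fst (snd v))"
    and "c \<equiv> (\<lambda>v :: fts. fst (snd (snd v)))"
    and "d \<equiv> (\<lambda>v :: fts. snd (snd (snd v)))"
  shows "quartic = (\<lambda>v. (-1) * (a v * a v * d v * d v) + 6 * (a v * b v * c v * d v)
    + 3 * (b v * b v * c v * c v) + (-4) * (a v * b v * b v * b v)
    + (-4) * (c v * c v * c v * d v))"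
proof
  fix v :: fts
  show "quartic v = (-1) * (a v * a v * d v * d v) + 6 * (a v * b v * c v * d v)
    + 3 * (b v * b v * c v * c v) + (-4) * (a v * b v * b v * b v)
    + (-4) * (c v * c v * c v * d v)"
    by (cases v) (simp add: a_def b_def c_def d_def jnorm_def jtrace_def jsharp_def
        power2_eq_square power3_eq_cube algebra_simps)
qed

lemma linear_components:
  "linear (fst :: fts \<Rightarrow> real)" "linear (\<lambda>v :: fts. fst (snd v))"
  "linear (\<lambda>v :: fts. fst (snd (snd v)))" "linear (\<lambda>v :: fts. snd (snd (snd v)))"
  by (auto intro!: linearI)

lemma linear_quartic_lin: "linear (quartic_lin x y w)"
proof -
  note l = linear_polarize4_prod[of _ _ _ _ x y w]
  have "linear (\<lambda>z. quartic_lin x y w z)"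
    unfolding quartic_lin_def quartic_alt polarize4_combine
    by (intro linear_compose_add linear_compose_scale_right[where 'b = real, simplified real_scaleR_def]
        l linear_components)
  then show ?thesis by simp
qed

lemma quartic_scaleR: "quartic (r *\<^sub>R x) = r ^ 4 * quartic x"
  by (cases x) (simp add: jnorm_def jtrace_def jsharp_def power2_eq_square power3_eq_cube
      power4_eq_xxxx algebra_simps)

lemma quartic_lin_diag: "quartic_lin x x x x = quartic x"
proof -
  have *: "x + x = 2 *\<^sub>R x" "2 *\<^sub>R x + x = 3 *\<^sub>R x" "3 *\<^sub>R x + x = 4 *\<^sub>R x"
    using scaleR_left_distrib[of 2 1 x] scaleR_left_distrib[of 3 1 x] by (simp_all add: scaleR_2)
  show ?thesis
    unfolding quartic_lin_def polarize4_def * quartic_scaleR by simp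
qed

lemma quartic_lin_sym:
  "quartic_lin x y w z = quartic_lin y x w z"
  "quartic_lin x y w z = quartic_lin x w y z"
  "quartic_lin x y w z = quartic_lin x y z w"
  by (simp_all add: quartic_lin_def polarize4_def add_ac)

lemma sform_represents:
  assumes "linear g"
  shows "\<exists>!t. \<forall>z. sform t z = g z"
proof (rule ex_ex1I)
  let ?t = "(g (0, 0, 0, 1), g (0, 0, 1, 0) / 3, - g (0, 1, 0, 0) / 3, - g (1, 0, 0, 0)) :: fts"
  have "sform ?t z = g z" for z
  proof (cases z)
    case (fields a b c d)
    have "z = a *\<^sub>R (1, 0, 0, 0) + b *\<^sub>R (0, 1, 0, 0) + c *\<^sub>R (0, 0, 1, 0) + d *\<^sub>R (0, 0, 0, 1)"
      using fields by simp
    then have "g z = a * g (1, 0, 0, 0) + b * g (0, 1, 0, 0) + c * g (0, 0, 1, 0)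
        + d * g (0, 0, 0, 1)"
      by (simp only: linear_add[OF assms] linear_scale[OF assms] real_scaleR_def)
    then show ?thesis using fields by (simp add: jtrace_def)
  qed
  then show "\<exists>t. \<forall>z. sform t z = g z" by blast
next
  fix t u :: fts
  assume *: "\<forall>z. sform t z = g z" "\<forall>z. sform u z = g z"
  have "sform t z = sform u z" for z using * by metis
  from this[of "(0, 0, 0, 1)"] this[of "(0, 0, 1, 0)"] this[of "(0, 1, 0, 0)"] this[of "(1, 0, 0, 0)"]
  show "t = u" by (cases t, cases u) (simp add: jtrace_def)
qed

lemma triple_ex1: "\<exists>!t. \<forall>z. sform t z = 2 * quartic_lin x y w z"
  using sform_represents[OF linear_compose_scale_right[OF linear_quartic_lin, of 2]] by simp

lemma sform_triple: "sform (triple x y w) z = 2 * quartic_lin x y w z"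
  using theI'[OF triple_ex1[of x y w]] unfolding triple_def by blast

definition rank1 :: "fts \<Rightarrow> bool" where
  "rank1 x \<longleftrightarrow> x \<noteq> 0 \<and> (\<forall>y. upsilon x y = 0)"

definition rank2 :: "fts \<Rightarrow> bool" where
  "rank2 x \<longleftrightarrow> x \<noteq> 0 \<and> triple x x x = 0 \<and> (\<exists>y. upsilon x y \<noteq> 0)"

definition rank3 :: "fts \<Rightarrow> bool" where
  "rank3 x \<longleftrightarrow> x \<noteq> 0 \<and> quartic x = 0 \<and> triple x x x \<noteq> 0"

definition rank4 :: "fts \<Rightarrow> bool" where
  "rank4 x \<longleftrightarrow> x \<noteq> 0 \<and> quartic x \<noteq> 0"

text \<open>Hypermatrix indices range over the two-element type \<open>2\<close>, whose elements are \<open>0\<close> and \<open>1\<close>.\<close>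

fun hypermatrix :: "fts \<Rightarrow> 2 \<Rightarrow> 2 \<Rightarrow> 2 \<Rightarrow> real" where
  "hypermatrix (\<alpha>, A, B, \<beta>) i j k =
     (if (i, j, k) = (0, 0, 0) then \<alpha>
      else if (i, j, k) \<in> {(1, 1, 0), (1, 0, 1), (0, 1, 1)} then A
      else if (i, j, k) \<in> {(0, 0, 1), (0, 1, 0), (1, 0, 0)} then B
      else \<beta>)"

definition hyper_action ::
    "real^2^2 \<Rightarrow> (2 \<Rightarrow> 2 \<Rightarrow> 2 \<Rightarrow> real) \<Rightarrow> (2 \<Rightarrow> 2 \<Rightarrow> 2 \<Rightarrow> real)" where
  "hyper_action M a = (\<lambda>i j k. \<Sum>i'\<in>UNIV. \<Sum>j'\<in>UNIV. \<Sum>k'\<in>UNIV.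
     M $ i $ i' * M $ j $ j' * M $ k $ k' * a i' j' k')"

definition sl2_related :: "fts \<Rightarrow> fts \<Rightarrow> bool" where
  "sl2_related x y \<longleftrightarrow>
     (\<exists>M :: real^2^2. det M = 1 \<and> hypermatrix y = hyper_action M (hypermatrix x))"

end

theory Submission
  imports Defs "HOL-Real_Asymp.Real_Asymp"
begin

text \<open>
  The totally symmetric hypermatrix of \<open>(\<alpha>, A, B, \<beta>)\<close> is the binary cubic form
  \<open>f(u, v) = \<alpha> u^3 + 3 B u^2 v + 3 A u v^2 + \<beta> v^3\<close>, on which \<open>SL(2, \<real>)\<close> acts by linear
  substitution, and the quartic form is, up to a positive factor, its discriminant. The classification is
  therefore that of real binary cubics up to unimodular substitution.

  A real cubic has a real linear factor, which can be moved to \<open>u\<close>, so that \<open>\<beta> = 0\<close>. What is left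
  is \<open>u\<close> times a quadratic form. Completing the square (a shear) or, if \<open>u\<close> is a repeated factor,
  moving that factor to \<open>v\<close> eliminates \<open>B\<close>, and a diagonal substitution then gives one of \<open>u^3\<close>,
  \<open>3 u v^2\<close>, \<open>k (u^3 - 3 u v^2)\<close> and \<open>k (u^3 + 3 u v^2)\<close>: a triple root, a double root, three simple
  real roots, and one real root with a pair of complex ones (\<open>sl2_related_canonical\<close>).

  It remains to match these four forms with the ranks. The three ranks in question exclude each
  other: \<open>\<Upsilon>(x, x, x) = 3 T(x)\<close> and \<open>{T(x), x} = 2 \<Delta>(x)\<close>, so rank 1 forces \<open>T(x) = 0\<close>, which forces
  \<open>\<Delta>(x) = 0\<close>. The substitutions preserve the quartic form and the antisymmetric form, hence
  everything that is built from these two, in particular the triple product, \<open>\<Upsilon>\<close> and the rank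
  (\<open>fts_automorphism\<close>, \<open>sl2_related_rank\<close>). So the ranks need to be computed for the four
  canonical forms only; rank 2 does not occur because none of the four has it.
\<close>

section \<open>Ranks and automorphisms of the triple system\<close>

lemma sform_self: "sform x x = 0"
  by (cases x) (simp add: jtrace_def)

lemma triple_eqI:
  assumes "\<And>z. sform t z = 2 * quartic_lin x y w z"
  shows "triple x y w = t"
  unfolding triple_def by (rule the1_equality[OF triple_ex1]) (use assms in blast)

lemma rank1_imp_triple_0:
  assumes "rank1 x"
  shows "triple x x x = 0"
proof -
  have "upsilon x x = 0"
    using assms unfolding rank1_def by blast
  then show ?thesis
    by (simp add: upsilon_def sform_self)
qed

lemma triple_0_imp_quartic_0:
  assumes "triple x x x = 0"
  shows "quartic x = 0"
proof -
  have "sform 0 x = 0"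
    by (cases x) (simp add: zero_prod_def jtrace_def)
  then show ?thesis
    using sform_triple[of x x x x] assms by (simp add: quartic_lin_diag)
qed

text \<open>Since \<open>triple\<close> is defined implicitly, by its pairing with all \<open>z\<close>, its equivariance needs every
  \<open>z\<close> to be in the range of \<open>g\<close>.\<close>

locale fts_automorphism =
  fixes g :: "fts \<Rightarrow> fts"
  assumes linear: "linear g"
    and bij: "bij g"
    and sform_image: "\<And>x y. sform (g x) (g y) = sform x y"
    and quartic_image: "\<And>x. quartic (g x) = quartic x"
begin

lemma eq_0_iff: "g x = 0 \<longleftrightarrow> x = 0"
  using bij_is_inj[OF bij] linear_0[OF linear] by (metis injD)

lemma quartic_lin_image: "quartic_lin (g x) (g y) (g w) (g z) = quartic_lin x y w z"
  unfolding quartic_lin_def polarize4_def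
  by (simp only: linear_add[OF linear, symmetric] quartic_image)

lemma triple_image: "triple (g x) (g y) (g w) = g (triple x y w)"
proof (rule triple_eqI)
  fix z
  obtain z' where "z = g z'"
    using bij_is_surj[OF bij] by (metis surjD)
  then show "sform (g (triple x y w)) z = 2 * quartic_lin (g x) (g y) (g w) z"
    by (simp add: sform_image quartic_lin_image sform_triple)
qed

lemma upsilon_image: "upsilon (g x) (g y) = g (upsilon x y)"
  unfolding upsilon_def triple_image sform_image
  by (simp add: linear_add[OF linear] linear_scale[OF linear])

lemma rank1_image_iff: "rank1 (g x) \<longleftrightarrow> rank1 x"
proof -
  have "(\<forall>y. upsilon (g x) y = 0) \<longleftrightarrow> (\<forall>y. upsilon (g x) (g y) = 0)"
    using bij_is_surj[OF bij] by (metis surjD)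
  then show ?thesis
    by (simp add: rank1_def eq_0_iff upsilon_image)
qed

lemma rank3_image_iff: "rank3 (g x) \<longleftrightarrow> rank3 x"
  by (simp add: rank3_def eq_0_iff quartic_image triple_image)

lemma rank4_image_iff: "rank4 (g x) \<longleftrightarrow> rank4 x"
  by (simp add: rank4_def eq_0_iff quartic_image)

end

section \<open>Linear substitutions in binary cubics\<close>

text \<open>These are the coefficients of the form \<open>f(p u + r v, q u + s v)\<close>, which is the binary cubic of
  the hypermatrix transformed by the matrix with rows \<open>(p, q)\<close> and \<open>(r, s)\<close>.\<close>

fun act :: "real \<Rightarrow> real \<Rightarrow> real \<Rightarrow> real \<Rightarrow> fts \<Rightarrow> fts" where
  "act p q r s (\<alpha>, A, B, \<beta>) =
    (p^3 * \<alpha> + 3 * p^2 * q * B + 3 * p * q^2 * A + q^3 * \<beta>,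
     p * r^2 * \<alpha> + (2 * p * r * s + q * r^2) * B + (2 * q * r * s + p * s^2) * A + q * s^2 * \<beta>,
     p^2 * r * \<alpha> + (2 * p * q * r + p^2 * s) * B + (q^2 * r + 2 * p * q * s) * A + q^2 * s * \<beta>,
     r^3 * \<alpha> + 3 * r^2 * s * B + 3 * r * s^2 * A + s^3 * \<beta>)"

text \<open>Hypermatrix indices are \<open>0\<close> and \<open>1\<close>, whereas \<open>UNIV_2\<close> and \<open>det_2\<close> name the two elements of the
  type \<open>1\<close> and \<open>2\<close>, with \<open>2 = 0\<close>.\<close>

lemma UNIV_2': "(UNIV :: 2 set) = {0, 1}"
proof -
  have "(2 :: 2) = 0" by simp
  then show ?thesis using UNIV_2 by auto
qed

lemma all_2': "(\<forall>i :: 2. P i) \<longleftrightarrow> P 0 \<and> P 1"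
  by (metis (full_types) UNIV_2' UNIV_I empty_iff insert_iff)

lemma det_2': "det (M :: real^2^2) = M $ 0 $ 0 * M $ 1 $ 1 - M $ 0 $ 1 * M $ 1 $ 0"
proof -
  have "(2 :: 2) = 0" by simp
  then show ?thesis by (simp only: det_2 mult.commute[of "M $ 1 $ 1"] mult.commute[of "M $ 1 $ 0"])
qed

lemma hypermatrix_act:
  "hypermatrix (act (M $ 0 $ 0) (M $ 0 $ 1) (M $ 1 $ 0) (M $ 1 $ 1) x) =
    hyper_action M (hypermatrix x)"
proof (cases x)
  case (fields \<alpha> A B \<beta>)
  have "\<forall>i j k. hypermatrix (act (M $ 0 $ 0) (M $ 0 $ 1) (M $ 1 $ 0) (M $ 1 $ 1) x) i j k =
      hyper_action M (hypermatrix x) i j k"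
    unfolding all_2' fields hyper_action_def UNIV_2'
    by (simp add: algebra_simps power2_eq_square power3_eq_cube)
  then show ?thesis by blast
qed

lemma hypermatrix_inject: "hypermatrix x = hypermatrix y \<longleftrightarrow> x = y"
proof
  assume eq: "hypermatrix x = hypermatrix y"
  have "hypermatrix x i j k = hypermatrix y i j k" for i j k
    by (simp add: eq)
  from this[of 0 0 0] this[of 0 1 1] this[of 0 0 1] this[of 1 1 1] show "x = y"
    by (cases x, cases y) simp
qed simp

lemma sl2_related_iff:
  "sl2_related x y \<longleftrightarrow> (\<exists>p q r s. p * s - q * r = 1 \<and> y = act p q r s x)"
proof
  assume "sl2_related x y"
  then obtain M where M: "det M = 1" "hypermatrix y = hyper_action M (hypermatrix x)"
    by (auto simp: sl2_related_def)
  have "M $ 0 $ 0 * M $ 1 $ 1 - M $ 0 $ 1 * M $ 1 $ 0 = 1"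
    using M(1) by (simp add: det_2')
  moreover have "y = act (M $ 0 $ 0) (M $ 0 $ 1) (M $ 1 $ 0) (M $ 1 $ 1) x"
    using M(2) by (simp add: hypermatrix_act[symmetric] hypermatrix_inject)
  ultimately show "\<exists>p q r s. p * s - q * r = 1 \<and> y = act p q r s x"
    by blast
next
  assume "\<exists>p q r s. p * s - q * r = 1 \<and> y = act p q r s x"
  then obtain p q r s where *: "p * s - q * r = 1" "y = act p q r s x"
    by blast
  define M :: "real^2^2" where
    "M = (\<chi> i j. if i = 0 then (if j = 0 then p else q) else (if j = 0 then r else s))"
  have M: "M $ 0 $ 0 = p" "M $ 0 $ 1 = q" "M $ 1 $ 0 = r" "M $ 1 $ 1 = s"
    by (simp_all add: M_def)
  have "det M = 1"
    using * M by (simp add: det_2')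
  moreover have "hypermatrix y = hyper_action M (hypermatrix x)"
    using hypermatrix_act[of M x] by (simp add: M *(2))
  ultimately show "sl2_related x y"
    unfolding sl2_related_def by blast
qed

lemma sl2_related_act: "p * s - q * r = 1 \<Longrightarrow> sl2_related x (act p q r s x)"
  by (auto simp: sl2_related_iff)

lemma act_act:
  "act p' q' r' s' (act p q r s x) =
    act (p' * p + q' * r) (p' * q + q' * s) (r' * p + s' * r) (r' * q + s' * s) x"
  by (cases x) (simp add: algebra_simps power2_eq_square power3_eq_cube)

lemma act_id: "act 1 0 0 1 x = x"
  by (cases x) simp

lemma sl2_related_trans:
  assumes "sl2_related x y" "sl2_related y z"
  shows "sl2_related x z"
proof -
  obtain p q r s where y: "p * s - q * r = 1" "y = act p q r s x"
    using assms(1) by (auto simp: sl2_related_iff)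
  obtain p' q' r' s' where z: "p' * s' - q' * r' = 1" "z = act p' q' r' s' y"
    using assms(2) by (auto simp: sl2_related_iff)
  have "(p' * p + q' * r) * (r' * q + s' * s) - (p' * q + q' * s) * (r' * p + s' * r) = 1"
    using y(1) z(1) by algebra
  then show ?thesis
    unfolding sl2_related_iff using y(2) z(2) act_act by metis
qed

lemma linear_act: "linear (act p q r s)"
proof (rule linearI)
  show "act p q r s (x + y) = act p q r s x + act p q r s y" for x y
    by (cases x, cases y) (simp add: algebra_simps)
  show "act p q r s (c *\<^sub>R x) = c *\<^sub>R act p q r s x" for c x
    by (cases x) (simp add: algebra_simps)
qed

lemma bij_act:
  assumes "p * s - q * r = 1"
  shows "bij (act p q r s)"
proof (rule o_bij)
  show "act s (- q) (- r) p \<circ> act p q r s = id"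
    using assms by (simp add: fun_eq_iff act_act act_id mult.commute)
  show "act p q r s \<circ> act s (- q) (- r) p = id"
    using assms by (simp add: fun_eq_iff act_act act_id mult.commute)
qed

lemma sform_act:
  assumes "p * s - q * r = 1"
  shows "sform (act p q r s x) (act p q r s y) = sform x y"
proof -
  have "sform (act p q r s x) (act p q r s y) = (p * s - q * r)^3 * sform x y"
    by (cases x, cases y) (simp add: jtrace_def algebra_simps power2_eq_square power3_eq_cube)
  then show ?thesis
    by (simp add: assms)
qed

text \<open>The coefficients of \<open>u^2\<close>, \<open>u v\<close> and \<open>v^2\<close> in the Hessian determinant of the cubic, divided by 36.
  The Hessian halves the degrees in the proof that the quartic form is invariant.\<close>

fun hessian :: "fts \<Rightarrow> real \<times> real \<times> real" where
  "hessian (\<alpha>, A, B, \<beta>) = (\<alpha> * A - B\<^sup>2, \<alpha> * \<beta> - A * B, B * \<beta> - A\<^sup>2)"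

lemma quartic_hessian:
  assumes "hessian x = (a, b, c)"
  shows "quartic x = 4 * a * c - b\<^sup>2"
proof (cases x)
  case (fields \<alpha> A B \<beta>)
  then have abc: "a = \<alpha> * A - B\<^sup>2" "b = \<alpha> * \<beta> - A * B" "c = B * \<beta> - A\<^sup>2"
    using assms by simp_all
  show ?thesis
    by (simp add: fields abc jnorm_def jtrace_def jsharp_def algebra_simps
        power2_eq_square power3_eq_cube)
qed

lemma hessian_act:
  assumes "p * s - q * r = 1" and "hessian x = (a, b, c)"
  shows "hessian (act p q r s x) =
    (p\<^sup>2 * a + p * q * b + q\<^sup>2 * c,
     2 * p * r * a + (p * s + q * r) * b + 2 * q * s * c,
     r\<^sup>2 * a + r * s * b + s\<^sup>2 * c)"
proof -
  have "hessian (act p q r s x) =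
    ((p * s - q * r)\<^sup>2 * (p\<^sup>2 * a + p * q * b + q\<^sup>2 * c),
     (p * s - q * r)\<^sup>2 * (2 * p * r * a + (p * s + q * r) * b + 2 * q * s * c),
     (p * s - q * r)\<^sup>2 * (r\<^sup>2 * a + r * s * b + s\<^sup>2 * c))"
  proof (cases x)
    case (fields \<alpha> A B \<beta>)
    then have abc: "a = \<alpha> * A - B\<^sup>2" "b = \<alpha> * \<beta> - A * B" "c = B * \<beta> - A\<^sup>2"
      using assms(2) by simp_all
    show ?thesis
      by (simp add: fields abc algebra_simps power2_eq_square power3_eq_cube)
  qed
  then show ?thesis
    by (simp add: assms(1))
qed

text \<open>The quartic form is minus the discriminant of the Hessian, and the discriminant of a quadratic
  form is multiplied by the squared determinant of a substitution.\<close>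

lemma quartic_act:
  assumes "p * s - q * r = 1"
  shows "quartic (act p q r s x) = quartic x"
proof -
  obtain a b c where h: "hessian x = (a, b, c)"
    by (cases "hessian x")
  have "quartic (act p q r s x) = (p * s - q * r)\<^sup>2 * (4 * a * c - b\<^sup>2)"
    unfolding quartic_hessian[OF hessian_act[OF assms h]] by algebra
  then show ?thesis
    by (simp add: assms quartic_hessian[OF h])
qed

lemma fts_automorphism_act:
  assumes "p * s - q * r = 1"
  shows "fts_automorphism (act p q r s)"
  by (rule fts_automorphism.intro) (simp_all only: linear_act bij_act sform_act quartic_act assms)

lemma sl2_related_rank:
  assumes "sl2_related x y"
  shows "rank1 x \<longleftrightarrow> rank1 y" "rank3 x \<longleftrightarrow> rank3 y" "rank4 x \<longleftrightarrow> rank4 y"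
  using assms fts_automorphism.rank1_image_iff fts_automorphism.rank3_image_iff
    fts_automorphism.rank4_image_iff fts_automorphism_act
  unfolding sl2_related_iff by metis+

section \<open>Reduction to canonical forms\<close>

lemma real_cubic_root:
  fixes b c d :: real
  shows "\<exists>t. t^3 + b * t^2 + c * t + d = 0"
proof -
  let ?f = "\<lambda>t :: real. t^3 + b * t^2 + c * t + d"
  have "filterlim ?f at_bot at_bot" by real_asymp
  then have "eventually (\<lambda>t. ?f t \<le> 0) at_bot" by (simp add: filterlim_at_bot)
  then obtain l where l: "\<And>t. t \<le> l \<Longrightarrow> ?f t \<le> 0" by (auto simp: eventually_at_bot_linorder)
  have "filterlim ?f at_top at_top" by real_asymp
  then have "eventually (\<lambda>t. 0 \<le> ?f t) at_top" by (simp add: filterlim_at_top)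
  then obtain u where u: "\<And>t. u \<le> t \<Longrightarrow> 0 \<le> ?f t" by (auto simp: eventually_at_top_linorder)
  have "\<exists>t\<ge>min l u. t \<le> max l u \<and> ?f t = 0"
    by (rule IVT') (auto intro!: l u continuous_intros)
  then show ?thesis by blast
qed

text \<open>The last entry of \<open>act p q r s x\<close> is \<open>f(r, s)\<close>, so any matrix of determinant 1 whose second row
  is a real zero of \<open>f\<close> will do. If \<open>\<alpha> = 0\<close>, then \<open>(1, 0)\<close> is such a zero; otherwise \<open>f(t, 1)\<close> has
  degree three in \<open>t\<close>.\<close>

lemma sl2_related_real_zero:
  "\<exists>\<alpha> A B. sl2_related x (\<alpha>, A, B, 0)"
proof (cases x)
  case (fields \<alpha> A B \<beta>)
  show ?thesis
  proof (cases "\<alpha> = 0")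
    case True
    then have "act 0 (-1) 1 0 x = (- \<beta>, - B, A, 0)"
      by (simp add: fields)
    then show ?thesis
      using sl2_related_act[of 0 0 "-1" 1 x] by auto
  next
    case False
    obtain t where "t^3 + 3 * B / \<alpha> * t^2 + 3 * A / \<alpha> * t + \<beta> / \<alpha> = 0"
      using real_cubic_root by blast
    then have t: "t^3 * \<alpha> + 3 * t^2 * B + 3 * t * A + \<beta> = 0"
      using False by (simp add: field_simps)
    have "act 1 0 t 1 x = (\<alpha>, t^2 * \<alpha> + 2 * t * B + A, t * \<alpha> + B, 0)"
      using t by (simp add: fields)
    then show ?thesis
      using sl2_related_act[of 1 1 0 t x] by auto
  qed
qed

lemma sl2_related_reduced:
  assumes "x \<noteq> 0"
  shows "\<exists>\<alpha> A. (\<alpha> \<noteq> 0 \<or> A \<noteq> 0) \<and> sl2_related x (\<alpha>, A, 0, 0)"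
proof -
  obtain \<alpha> A B where *: "sl2_related x (\<alpha>, A, B, 0)"
    using sl2_related_real_zero by blast
  consider "A \<noteq> 0" | "A = 0" "B \<noteq> 0" | "A = 0" "B = 0"
    by blast
  then show ?thesis
  proof cases
    case 1
    \<comment> \<open>This shear completes the square in the quadratic factor \<open>\<alpha> u^2 + 3 B u v + 3 A v^2\<close>.\<close>
    define q where "q = - B / (2 * A)"
    have "act 1 q 0 1 (\<alpha>, A, B, 0) = (\<alpha> + 3 * q * B + 3 * q^2 * A, A, 0, 0)"
      using 1 by (simp add: q_def)
    then have "sl2_related (\<alpha>, A, B, 0) (\<alpha> + 3 * q * B + 3 * q^2 * A, A, 0, 0)"
      using sl2_related_act[of 1 1 q 0 "(\<alpha>, A, B, 0)"] by simp
    then show ?thesis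
      using sl2_related_trans[OF *] 1 by blast
  next
    case 2
    \<comment> \<open>The cubic is \<open>u^2 (\<alpha> u + 3 B v)\<close>. The substitution takes the second factor to a multiple of
      \<open>u\<close> and the repeated factor \<open>u\<close> to \<open>- v\<close>.\<close>
    define t where "t = \<alpha> / (3 * B)"
    have "act 0 1 (-1) t (\<alpha>, A, B, 0) = (0, B, 0, 0)"
      using 2 by (simp add: t_def field_simps power2_eq_square power3_eq_cube)
    then have "sl2_related (\<alpha>, A, B, 0) (0, B, 0, 0)"
      using sl2_related_act[of 0 t 1 "-1" "(\<alpha>, A, B, 0)"] by simp
    then show ?thesis
      using sl2_related_trans[OF *] 2 by blast
  next
    case 3
    have "\<alpha> \<noteq> 0"
    proof
      assume "\<alpha> = 0"
      then have "sl2_related x 0"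
        using * 3 by (simp add: zero_prod_def)
      then show False
        using assms fts_automorphism.eq_0_iff fts_automorphism_act
        unfolding sl2_related_iff by metis
    qed
    then show ?thesis
      using * 3 by blast
  qed
qed

lemma sl2_related_scale:
  assumes "t \<noteq> 0"
  shows "sl2_related (\<alpha>, A, 0, 0) (t^3 * \<alpha>, A / t, 0, 0)"
  using sl2_related_act[of t "1 / t" 0 0 "(\<alpha>, A, 0, 0)"] assms
  by (simp add: power2_eq_square)

lemma sl2_related_canonical:
  assumes "x \<noteq> 0"
  shows "sl2_related x (1, 0, 0, 0) \<or> sl2_related x (0, 1, 0, 0)
    \<or> (\<exists>k>0. sl2_related x (k *\<^sub>R (1, -1, 0, 0)) \<or> sl2_related x (k *\<^sub>R (1, 1, 0, 0)))"
proof -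
  obtain \<alpha> A where "\<alpha> \<noteq> 0 \<or> A \<noteq> 0" and *: "sl2_related x (\<alpha>, A, 0, 0)"
    using sl2_related_reduced[OF assms] by blast
  then consider "\<alpha> \<noteq> 0" "A = 0" | "\<alpha> = 0" "A \<noteq> 0" | "\<alpha> \<noteq> 0" "A \<noteq> 0"
    by blast
  then show ?thesis
  proof cases
    case 1
    define t where "t = root 3 (1 / \<alpha>)"
    have "t^3 = 1 / \<alpha>" "t \<noteq> 0"
      using 1 by (simp_all add: t_def odd_real_root_pow)
    then have "sl2_related (\<alpha>, A, 0, 0) (1, 0, 0, 0)"
      using sl2_related_scale[of t \<alpha> A] 1 by simp
    then show ?thesis
      using sl2_related_trans[OF *] by blast
  next
    case 2
    then have "sl2_related (\<alpha>, A, 0, 0) (0, 1, 0, 0)"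
      using sl2_related_scale[of A \<alpha> A] by simp
    then show ?thesis
      using sl2_related_trans[OF *] by blast
  next
    case 3
    \<comment> \<open>The modulus of \<open>t\<close> makes the two entries equal in modulus, its sign makes the first one
      positive.\<close>
    define m where "m = root 4 \<bar>A / \<alpha>\<bar>"
    define t where "t = sgn \<alpha> * m"
    have m: "m > 0" "m^4 = \<bar>A\<bar> / \<bar>\<alpha>\<bar>"
      using 3 by (simp_all add: m_def)
    define k where "k = m^3 * \<bar>\<alpha>\<bar>"
    have k: "k > 0" and t: "t \<noteq> 0"
      using m 3 by (simp_all add: k_def t_def sgn_0_0)
    have km: "k * m = \<bar>A\<bar>"
      using m 3 by (simp add: k_def power4_eq_xxxx power3_eq_cube field_simps)
    have "t^3 * \<alpha> = k"
      using 3 by (cases "\<alpha> > 0") (simp_all add: t_def k_def)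
    moreover have "A / t = sgn (A * \<alpha>) * k"
    proof -
      have "A = sgn A * (k * m)"
        by (simp add: km sgn_mult_abs)
      then have "A * sgn \<alpha> = sgn (A * \<alpha>) * k * m"
        by (simp add: sgn_mult)
      then show ?thesis
        using m 3 by (cases "\<alpha> > 0") (auto simp: t_def field_simps)
    qed
    ultimately have "sl2_related (\<alpha>, A, 0, 0) (k, sgn (A * \<alpha>) * k, 0, 0)"
      using sl2_related_scale[OF t] by metis
    moreover have "sgn (A * \<alpha>) = 1 \<or> sgn (A * \<alpha>) = -1"
      using 3 by (auto simp: sgn_if)
    ultimately have "sl2_related x (k *\<^sub>R (1, -1, 0, 0)) \<or> sl2_related x (k *\<^sub>R (1, 1, 0, 0))"
      using sl2_related_trans[OF *] by auto
    then show ?thesis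
      using k by blast
  qed
qed

section \<open>Ranks of the canonical forms\<close>

text \<open>The only monomial of the quartic form of degree at least two in \<open>\<alpha>\<close> is \<open>- \<alpha>^2 \<beta>^2\<close>, and its
  polarization gives the triple product with two arguments \<open>(1, 0, 0, 0)\<close>.\<close>

lemma rank1_cube: "rank1 (1, 0, 0, 0)"
proof -
  have "upsilon (1, 0, 0, 0) y = 0" for y
  proof (cases y)
    case (fields \<alpha> A B \<beta>)
    have "triple (1, 0, 0, 0) (1, 0, 0, 0) y = (- \<beta> / 3, 0, 0, 0)"
    proof (rule triple_eqI)
      show "sform (- \<beta> / 3, 0, 0, 0) z = 2 * quartic_lin (1, 0, 0, 0) (1, 0, 0, 0) y z" for z
        unfolding fields
        by (cases z) (simp add: quartic_lin_def polarize4_def jnorm_def jtrace_def jsharp_def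
            algebra_simps power2_eq_square power3_eq_cube)
    qed
    then show ?thesis
      by (simp add: upsilon_def fields jtrace_def zero_prod_def)
  qed
  then show ?thesis
    by (simp add: rank1_def zero_prod_def)
qed

lemma rank3_double_root: "rank3 (0, 1, 0, 0)"
proof -
  let ?x = "(0, 1, 0, 0) :: fts"
  \<comment> \<open>The monomial \<open>- 4 \<alpha> A^3\<close> of the quartic form shows that the triple product does not vanish.\<close>
  have "quartic_lin ?x ?x ?x (1, 0, 0, 0) = - 1"
    by (simp add: quartic_lin_def polarize4_def jnorm_def jtrace_def jsharp_def)
  then have "sform (triple ?x ?x ?x) (1, 0, 0, 0) = - 2"
    by (simp add: sform_triple)
  then have "triple ?x ?x ?x \<noteq> 0"
    by (auto simp: zero_prod_def jtrace_def)
  then show ?thesis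
    by (simp add: rank3_def jnorm_def jtrace_def jsharp_def zero_prod_def)
qed

lemma rank4_simple_roots:
  assumes "k \<noteq> 0"
  shows "rank4 (k *\<^sub>R (1, -1, 0, 0))" "rank4 (k *\<^sub>R (1, 1, 0, 0))"
  using assms by (simp_all add: rank4_def jnorm_def jtrace_def jsharp_def zero_prod_def)

theorem theorem4:
  fixes x :: fts
  assumes "x \<noteq> 0"
  shows "(rank1 x \<or> rank3 x \<or> rank4 x)
    \<and> (rank1 x \<longrightarrow> sl2_related x (1, 0, 0, 0))
    \<and> (rank3 x \<longrightarrow> sl2_related x (0, 1, 0, 0))
    \<and> (rank4 x \<longrightarrow> (\<exists>k>0. sl2_related x (k *\<^sub>R (1, -1, 0, 0))
                        \<or> sl2_related x (k *\<^sub>R (1, 1, 0, 0))))"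
proof -
  have excl: "\<not> (rank1 x \<and> rank3 x)" "\<not> (rank1 x \<and> rank4 x)" "\<not> (rank3 x \<and> rank4 x)"
    using rank1_imp_triple_0[of x] triple_0_imp_quartic_0[of x]
    by (auto simp: rank3_def rank4_def)
  consider "sl2_related x (1, 0, 0, 0)" | "sl2_related x (0, 1, 0, 0)"
    | "\<exists>k>0. sl2_related x (k *\<^sub>R (1, -1, 0, 0)) \<or> sl2_related x (k *\<^sub>R (1, 1, 0, 0))"
    using sl2_related_canonical[OF assms] by blast
  then show ?thesis
  proof cases
    case 1
    then have "rank1 x"
      using sl2_related_rank(1) rank1_cube by blast
    then show ?thesis
      using 1 excl by blast
  next
    case 2
    then have "rank3 x"
      using sl2_related_rank(2) rank3_double_root by blast
    then show ?thesis
      using 2 excl by blast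
  next
    case 3
    then have "rank4 x"
      using sl2_related_rank(3) rank4_simple_roots by (metis less_irrefl)
    then show ?thesis
      using 3 excl by blast
  qed
qed

end
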